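(* Let $e(n,k)$ denote the expected number of integer times $j\in\{1,\dots,\lfloor k\rfloor\}$ at which the $n$-detachment process is in a state of detachment, i.e. $e(n,k)=E^{(n)}\big(\sum_{j=1}^{\lfloor k\rfloor}X_j\big)$ with $X_j:=\mathbf{1}\{L_j=n\}$. (a) Suppose $k(n)\sim \dfrac{n^2}{c\log n}$ as $n\to\infty$, where $c>0$ is a constant. If $c>4$, then $e(n,k(n))\to0$ as $n\to\infty$, i.e. $\sum_{j=1}^{\lfloor k(n)\rfloor}X_j\to0$ in $L^1$. If $c<4$, then $e(n,k(n))\to\infty$. (b) If $y>0$ and $$k(n)=k(n,y):=\frac{n^2}{2\,(2\log n-2\log\log n+y)}\sim\frac{n^2}{4\log n},$$ then $$\lim_{n\to\infty}e(n,k(n))=\frac{e^{-y}}{8}.$$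
   Context: The $n$-detachment process ($n\ge1$): there are $n$ labeled passengers. At time $1$ all passengers sit in bus number $1$. At each integer time $k\ge 2$, a new bus with number $k$ becomes available and each passenger (currently sitting in one of the buses $1,\dots,k-1$), independently of the others and of the past, relocates to bus $k$ with probability $1/k$ and otherwise stays where they are. $P^{(n)},E^{(n)}$ denote probability and expectation for $n$ passengers. A passenger is lonely at time $k$ if no other passenger is in the same bus at time $k$; $L_k$ denotes the number of lonely passengers at time $k$. The process is in a state of detachment at time $k$ if $L_k=n$. The notation $a_n\sim b_n$ means $a_n/b_n\to1$; $\log$ is the natural logarithm. *)

theory Defs
  imports "HOL-Probability.Probability" "HOL-Library.Landau_Symbols"
begin

text \<open>
  The process is realised on its canonical space: the coordinates \<open>\<omega> (i, k)\<close>, for passengers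
  \<open>i < n\<close> and times \<open>k \<ge> 2\<close>, are independent, and \<open>\<omega> (i, k)\<close> says that passenger \<open>i\<close>
  relocates at time \<open>k\<close>, which has probability \<open>1 / k\<close>.
\<close>

definition detachment_space :: "nat \<Rightarrow> (nat \<times> nat \<Rightarrow> bool) measure" where
  "detachment_space n =
     (\<Pi>\<^sub>M (i, k) \<in> {..<n} \<times> {2..}. measure_pmf (bernoulli_pmf (1 / real k)))"

text \<open>The bus of passenger \<open>i\<close> at time \<open>k\<close>; time starts at 1, so the value at time 0 is a dummy.\<close>

fun bus :: "(nat \<times> nat \<Rightarrow> bool) \<Rightarrow> nat \<Rightarrow> nat \<Rightarrow> nat" where
  "bus \<omega> i 0 = 1"
| "bus \<omega> i (Suc 0) = 1"
| "bus \<omega> i (Suc (Suc k)) =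
     (if \<omega> (i, Suc (Suc k)) then Suc (Suc k) else bus \<omega> i (Suc k))"

definition lonely :: "nat \<Rightarrow> (nat \<times> nat \<Rightarrow> bool) \<Rightarrow> nat \<Rightarrow> nat \<Rightarrow> bool" where
  "lonely n \<omega> k i \<longleftrightarrow> (\<forall>j<n. j \<noteq> i \<longrightarrow> bus \<omega> j k \<noteq> bus \<omega> i k)"

definition num_lonely :: "nat \<Rightarrow> nat \<Rightarrow> (nat \<times> nat \<Rightarrow> bool) \<Rightarrow> nat" where
  "num_lonely n k \<omega> = card {i. i < n \<and> lonely n \<omega> k i}"

definition detached :: "nat \<Rightarrow> nat \<Rightarrow> (nat \<times> nat \<Rightarrow> bool) \<Rightarrow> real" where
  "detached n k \<omega> = of_bool (num_lonely n k \<omega> = n)"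

definition num_detached :: "nat \<Rightarrow> real \<Rightarrow> (nat \<times> nat \<Rightarrow> bool) \<Rightarrow> real" where
  "num_detached n x \<omega> = (\<Sum>j = 1..nat \<lfloor>x\<rfloor>. detached n j \<omega>)"

definition expected_detached :: "nat \<Rightarrow> real \<Rightarrow> real" where
  "expected_detached n x = (\<integral>\<omega>. num_detached n x \<omega> \<partial>detachment_space n)"

text \<open>Convergence to 0 in \<open>L\<^sup>1\<close> when each member of the sequence has its own probability space.\<close>

definition tendsto_zero_L1 :: "(nat \<Rightarrow> 'a measure) \<Rightarrow> (nat \<Rightarrow> 'a \<Rightarrow> real) \<Rightarrow> bool" where
  "tendsto_zero_L1 M f \<longleftrightarrow>
     (\<forall>n. integrable (M n) (f n)) \<and> (\<lambda>n. \<integral>\<omega>. \<bar>f n \<omega>\<bar> \<partial>M n) \<longlonglongrightarrow> 0"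

end

theory Submission
  imports Defs "HOL-Real_Asymp.Real_Asymp"
begin

text \<open>
  At time \<open>k\<close> the buses of the passengers are independent and uniform on \<open>{1..k}\<close>, so detachment has
  probability \<open>\<Prod>i<n. (1 - i / k)\<close>. With \<open>a = n (n - 1) / 2\<close> this lies between
  \<open>exp (- a / (k - n))\<close> and \<open>exp (- a / k)\<close>, so up to a shift of \<open>x\<close> by \<open>n\<close> everything reduces to
  the sum of \<open>exp (- a / k)\<close> over \<open>k \<le> x\<close>. The function \<open>G x = x\<^sup>2 exp (- a / x)\<close> has derivative
  \<open>(a + 2 x) exp (- a / x)\<close>, so by telescoping that sum lies between \<open>G x / (a + 2 x)\<close> and
  \<open>G x / a\<close> up to unit shifts, and these bounds agree asymptotically when \<open>x\<close> is \<open>o(n\<^sup>2)\<close>.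
\<close>

section \<open>Law of a single passenger's bus\<close>

lemma bus_range: "1 \<le> k \<Longrightarrow> bus \<omega> i k \<in> {1..k}"
proof (induction k rule: dec_induct)
  case (step k)
  then show ?case by (cases k) auto
qed auto

text \<open>Bus \<open>b\<close> is occupied iff the last relocation was at time \<open>b\<close> (\<open>b = 1\<close>: no relocation at all).
  The set contains the admissible values of the relocation flag at time \<open>l\<close>.\<close>

definition bus_event :: "nat \<Rightarrow> nat \<Rightarrow> bool set" where
  "bus_event b l = (if l < b then UNIV else {l = b})"

lemma bus_eq_iff:
  assumes "1 \<le> k" "b \<in> {1..k}"
  shows "bus \<omega> i k = b \<longleftrightarrow> (\<forall>l\<in>{2..k}. \<omega> (i, l) \<in> bus_event b l)"
  using assms
proof (induction k rule: dec_induct)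
  case base
  then show ?case by auto
next
  case (step k)
  then obtain m where m: "k = Suc m" by (cases k) auto
  have split: "{2..Suc k} = insert (Suc k) {2..k}" using step by auto
  \<comment> \<open>Since bus \<open>Suc k\<close> did not exist before, it can be occupied at time
    \<open>Suc k\<close> only through a relocation at that very time.\<close>
  have le: "bus \<omega> i k \<le> k" using bus_range[of k \<omega> i] step by auto
  show ?case
  proof (cases "b = Suc k")
    case True
    then show ?thesis using le m by (auto simp: split bus_event_def)
  next
    case False
    then have "b \<in> {1..k}" using step.prems by auto
    with step.IH have IH: "bus \<omega> i k = b \<longleftrightarrow> (\<forall>l\<in>{2..k}. \<omega> (i, l) \<in> bus_event b l)" by blast
    have "bus \<omega> i (Suc k) = b \<longleftrightarrow> \<not> \<omega> (i, Suc k) \<and> bus \<omega> i k = b"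
      using False m by auto
    moreover have "\<omega> (i, Suc k) \<in> bus_event b (Suc k) \<longleftrightarrow> \<not> \<omega> (i, Suc k)"
      using False step.prems by (simp add: bus_event_def)
    ultimately show ?thesis by (auto simp: split IH)
  qed
qed

text \<open>The factors are 1 for \<open>l < b\<close>, \<open>1 / b\<close> at
  \<open>l = b\<close>, and \<open>(l - 1) / l\<close> afterwards, where they telescope to
  \<open>b / k\<close>. For \<open>b = 1\<close> all factors are of the last type.\<close>

lemma prod_bus_event:
  assumes "1 \<le> k" "b \<in> {1..k}"
  shows "(\<Prod>l\<in>{2..k}. measure_pmf.prob (bernoulli_pmf (1 / real l)) (bus_event b l)) = 1 / real k"
  using assms
proof (induction k rule: dec_induct)
  case base
  then show ?case by auto
next
  case (step k)
  have split: "{2..Suc k} = insert (Suc k) {2..k}" using step by auto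
  show ?case
  proof (cases "b = Suc k")
    case True
    have "(\<Prod>l\<in>{2..k}. measure_pmf.prob (bernoulli_pmf (1 / real l)) (bus_event b l)) = 1"
      by (rule prod.neutral) (auto simp: True bus_event_def)
    moreover have "measure_pmf.prob (bernoulli_pmf (1 / real (Suc k))) (bus_event b (Suc k)) = 1 / real (Suc k)"
      by (simp add: True bus_event_def measure_pmf_single)
    ultimately show ?thesis by (simp add: split)
  next
    case False
    then have b: "b \<in> {1..k}" using step.prems by auto
    have "measure_pmf.prob (bernoulli_pmf (1 / real (Suc k))) (bus_event b (Suc k)) = real k / real (Suc k)"
      using b by (simp add: bus_event_def measure_pmf_single field_simps)
    then have "(\<Prod>l\<in>{2..Suc k}. measure_pmf.prob (bernoulli_pmf (1 / real l)) (bus_event b l)) =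
        real k / real (Suc k) * (1 / real k)"
      using step.IH[OF b] by (simp add: split)
    then show ?thesis using step.hyps by simp
  qed
qed

section \<open>Joint law of the buses and the detachment probability\<close>

lemma product_prob_space_bernoulli:
  "product_prob_space (\<lambda>(i :: nat, k). measure_pmf (bernoulli_pmf (1 / real k)))"
  by (intro product_prob_spaceI) (auto split: prod.split simp: measure_pmf.prob_space_axioms)

lemma prob_space_detachment_space: "prob_space (detachment_space n)"
  unfolding detachment_space_def
  by (intro prob_space_PiM) (auto simp: measure_pmf.prob_space_axioms)

text \<open>Fixing all buses at time \<open>k\<close> constrains only the finitely many coordinates
  in \<open>J\<close>, so the event is a cylinder and its measure factorises, with
  \<open>1 / k\<close> for each passenger.\<close>

lemma buses_event:
  assumes k: "1 \<le> k" and f: "\<And>i. i < n \<Longrightarrow> f i \<in> {1..k}"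
  defines "A \<equiv> {\<omega> \<in> space (detachment_space n). \<forall>i<n. bus \<omega> i k = f i}"
  shows "A \<in> sets (detachment_space n)" "measure (detachment_space n) A = (1 / real k) ^ n"
proof -
  define M :: "nat \<times> nat \<Rightarrow> bool measure"
    where "M = (\<lambda>(i, l). measure_pmf (bernoulli_pmf (1 / real l)))"
  define I where "I = {..<n} \<times> {2::nat..}"
  define J where "J = {..<n} \<times> {2..k}"
  define X where "X = (\<lambda>(i, l). bus_event (f i) l)"
  interpret product_prob_space M I
    unfolding M_def by (rule product_prob_space_bernoulli)
  have sp: "detachment_space n = PiM I M"
    by (simp add: detachment_space_def I_def M_def)
  have J: "J \<subseteq> I" "finite J" by (auto simp: I_def J_def)
  have X: "X p \<in> sets (M p)" for p by (auto simp: M_def split: prod.splits)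
  have A: "A = prod_emb I M J (Pi\<^sub>E J X)"
  proof -
    have "A = {\<omega> \<in> space (PiM I M). \<forall>p\<in>J. \<omega> p \<in> X p}"
      using bus_eq_iff[OF k f] by (auto simp: A_def sp J_def X_def)
    also have "\<dots> = prod_emb I M J (Pi\<^sub>E J X)"
      using J by (auto simp: prod_emb_def space_PiM Pi_iff)
    finally show ?thesis .
  qed
  show "A \<in> sets (detachment_space n)"
    unfolding A sp using J X by (intro sets_PiM_I) auto
  have "measure (detachment_space n) A = (\<Prod>p\<in>J. measure (M p) (X p))"
    unfolding A sp by (rule measure_PiM_emb) (use J X in auto)
  also have "\<dots> = (\<Prod>i<n. \<Prod>l\<in>{2..k}. measure_pmf.prob (bernoulli_pmf (1 / real l)) (bus_event (f i) l))"
    by (simp add: J_def M_def X_def prod.cartesian_product case_prod_unfold)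
  also have "\<dots> = (1 / real k) ^ n"
    using prod_bus_event[OF k f] by simp
  finally show "measure (detachment_space n) A = (1 / real k) ^ n" .
qed

text \<open>A subset of \<open>{..<n}\<close> with \<open>n\<close> elements is the whole set, so
  everybody must be lonely.\<close>

lemma num_lonely_eq_iff: "num_lonely n k \<omega> = n \<longleftrightarrow> inj_on (\<lambda>i. bus \<omega> i k) {..<n}"
proof -
  have "num_lonely n k \<omega> = n \<longleftrightarrow> {i. i < n \<and> lonely n \<omega> k i} = {..<n}"
  proof
    assume "num_lonely n k \<omega> = n"
    then show "{i. i < n \<and> lonely n \<omega> k i} = {..<n}"
      by (intro card_subset_eq) (auto simp: num_lonely_def)
  qed (simp add: num_lonely_def)
  then show ?thesis
    by (auto simp: lonely_def inj_on_def set_eq_iff)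
qed

text \<open>Detachment is the disjoint union, over injective assignments \<open>f\<close>, of the
  events fixing all buses; the injections are counted by a falling factorial. For
  \<open>k < n\<close> truncated subtraction makes the factor at \<open>i = k\<close> vanish, in
  line with the pigeonhole principle.\<close>

lemma detachment_event:
  fixes n k :: nat
  assumes k: "1 \<le> k"
  defines "A \<equiv> {\<omega> \<in> space (detachment_space n). num_lonely n k \<omega> = n}"
  shows "A \<in> sets (detachment_space n)"
    "measure (detachment_space n) A = (\<Prod>i<n. real (k - i) / real k)"
proof -
  interpret prob_space "detachment_space n" by (rule prob_space_detachment_space)
  define F where "F = {f \<in> {..<n} \<rightarrow>\<^sub>E {1..k}. inj_on f {..<n}}"
  define C where "C = (\<lambda>f. {\<omega> \<in> space (detachment_space n). \<forall>i<n. bus \<omega> i k = f i})"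
  have finF: "finite F"
    unfolding F_def by (rule finite_subset[OF _ finite_PiE[of "{..<n}" "\<lambda>_. {1..k}"]]) auto
  have C: "C f \<in> events" "prob (C f) = (1 / real k) ^ n" if "f \<in> F" for f
  proof -
    have "f i \<in> {1..k}" if "i < n" for i
      using PiE_mem[of f "{..<n}" "\<lambda>_. {1..k}" i] \<open>f \<in> F\<close> that by (simp add: F_def)
    note ev = buses_event[OF k this]
    show "C f \<in> events" unfolding C_def by (rule ev(1))
    show "prob (C f) = (1 / real k) ^ n" unfolding C_def by (rule ev(2))
  qed
  have A: "A = (\<Union>f\<in>F. C f)"
  proof (intro equalityI subsetI)
    fix \<omega> assume \<omega>: "\<omega> \<in> A"
    \<comment> \<open>Restriction makes the assignment extensional, hence a member of the finite
      function space in \<open>F\<close>.\<close>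
    define f where "f = restrict (\<lambda>i. bus \<omega> i k) {..<n}"
    have "f \<in> F" using \<omega> bus_range[OF k, of \<omega>]
      by (auto simp: F_def A_def f_def num_lonely_eq_iff)
    moreover have "\<omega> \<in> C f" using \<omega> by (auto simp: A_def C_def f_def)
    ultimately show "\<omega> \<in> (\<Union>f\<in>F. C f)" by blast
  next
    fix \<omega> assume "\<omega> \<in> (\<Union>f\<in>F. C f)"
    then obtain f where f: "inj_on f {..<n}" "\<omega> \<in> C f" by (auto simp: F_def)
    then have "inj_on (\<lambda>i. bus \<omega> i k) {..<n}"
      by (subst inj_on_cong[of _ _ f]) (auto simp: C_def)
    with f show "\<omega> \<in> A" by (simp add: A_def C_def num_lonely_eq_iff)
  qed
  show "A \<in> events" unfolding A using finF C by auto
  have disj: "disjoint_family_on C F"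
    unfolding disjoint_family_on_def
  proof (intro ballI impI)
    fix f g assume fg: "f \<in> F" "g \<in> F" "f \<noteq> g"
    \<comment> \<open>Both functions are extensional, so if distinct they differ at some
      passenger.\<close>
    have "\<exists>i<n. f i \<noteq> g i"
    proof (rule ccontr)
      assume "\<not> ?thesis"
      then have "f = g" using fg by (intro PiE_ext[of f "{..<n}" "\<lambda>_. {1..k}" g]) (auto simp: F_def)
      with fg show False by blast
    qed
    then show "C f \<inter> C g = {}" by (auto simp: C_def)
  qed
  have "prob A = (\<Sum>f\<in>F. prob (C f))"
    unfolding A by (rule finite_measure_finite_Union) (use finF C disj in auto)
  also have "\<dots> = real (card F) * (1 / real k) ^ n" using C by simp
  also have "card F = (\<Prod>i<n. k - i)"
    unfolding F_def by (subst card_inj_on_subset_funcset) (auto simp: lessThan_atLeast0)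
  finally show "prob A = (\<Prod>i<n. real (k - i) / real k)"
    by (simp add: prod_dividef power_one_over)
qed

text \<open>Linearity of expectation disposes of the dependence between times and leaves a
  deterministic sum.\<close>

lemma expected_detached_eq:
  "integrable (detachment_space n) (num_detached n x)"
  "expected_detached n x = (\<Sum>k = 1..nat \<lfloor>x\<rfloor>. \<Prod>i<n. real (k - i) / real k)"
proof -
  interpret prob_space "detachment_space n" by (rule prob_space_detachment_space)
  define A where "A = (\<lambda>k. {\<omega> \<in> space (detachment_space n). num_lonely n k \<omega> = n})"
  have ind: "detached n k \<omega> = indicator (A k) \<omega>" if "\<omega> \<in> space (detachment_space n)" for k \<omega>
    using that by (simp add: detached_def A_def indicator_def)
  have A: "A k \<in> events" "prob (A k) = (\<Prod>i<n. real (k - i) / real k)" if "1 \<le> k" for k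
    using detachment_event[OF that] by (auto simp: A_def)
  have int: "integrable (detachment_space n) (detached n k)" if "1 \<le> k" for k
    using A(1)[OF that]
    by (subst Bochner_Integration.integrable_cong[OF refl ind]) (auto simp: emeasure_eq_measure)
  have eq: "(\<integral>\<omega>. detached n k \<omega> \<partial>detachment_space n) = (\<Prod>i<n. real (k - i) / real k)"
    if "1 \<le> k" for k
    using A[OF that] by (subst Bochner_Integration.integral_cong[OF refl ind]) auto
  show "integrable (detachment_space n) (num_detached n x)"
    unfolding num_detached_def using int by (intro Bochner_Integration.integrable_sum) auto
  have "expected_detached n x = (\<Sum>k = 1..nat \<lfloor>x\<rfloor>. \<integral>\<omega>. detached n k \<omega> \<partial>detachment_space n)"
    unfolding expected_detached_def num_detached_def
    using int by (intro Bochner_Integration.integral_sum) auto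
  then show "expected_detached n x = (\<Sum>k = 1..nat \<lfloor>x\<rfloor>. \<Prod>i<n. real (k - i) / real k)"
    using eq by simp
qed

section \<open>Exponential bounds for the detachment probability\<close>

lemma prod_one_minus_le_exp:
  assumes "1 \<le> k"
  shows "(\<Prod>i<n. real (k - i) / real k) \<le> exp (- (real n * (real n - 1) / 2) / real k)"
proof -
  have "real (k - i) / real k \<le> exp (- (real i / real k))" for i
  proof (cases "i \<le> k")
    case True
    have "real (k - i) / real k = 1 + - (real i / real k)"
      using True assms by (simp add: field_simps)
    also have "\<dots> \<le> exp (- (real i / real k))" by (rule exp_ge_add_one_self)
    finally show ?thesis .
  qed simp
  then have "(\<Prod>i<n. real (k - i) / real k) \<le> (\<Prod>i<n. exp (- (real i / real k)))"
    by (intro prod_mono) auto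
  also have "\<dots> = exp (- ((\<Sum>i<n. real i) / real k))"
    by (simp add: exp_sum[symmetric] sum_negf sum_divide_distrib)
  also have "(\<Sum>i<n. real i) = real n * (real n - 1) / 2"
    by (induction n) (auto simp: field_simps)
  finally show ?thesis by simp
qed

text \<open>The inequality \<open>1 + t \<le> exp t\<close> is applied to the reciprocal factor
  \<open>k / (k - i) = 1 + i / (k - i)\<close>.\<close>

lemma exp_le_prod_one_minus:
  assumes "n < k"
  shows "exp (- (real n * (real n - 1) / 2) / real (k - n)) \<le> (\<Prod>i<n. real (k - i) / real k)"
proof -
  have bound: "exp (- (real i / real (k - n))) \<le> real (k - i) / real k" if "i < n" for i
  proof -
    have "real k / real (k - i) = 1 + real i / real (k - i)"
      using that assms by (simp add: field_simps)
    also have "\<dots> \<le> exp (real i / real (k - i))" by (rule exp_ge_add_one_self)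
    \<comment> \<open>A common denominator lets the exponents add up; this is the origin of the
      shift by \<open>n\<close>.\<close>
    also have "\<dots> \<le> exp (real i / real (k - n))"
      using that assms by (auto intro!: divide_left_mono)
    finally show ?thesis
      using that assms by (simp add: exp_minus field_simps)
  qed
  have "(\<Sum>i<n. real i) = real n * (real n - 1) / 2"
    by (induction n) (auto simp: field_simps)
  then have "exp (- (real n * (real n - 1) / 2) / real (k - n)) = exp (- ((\<Sum>i<n. real i) / real (k - n)))"
    by (simp only: minus_divide_left)
  also have "\<dots> = (\<Prod>i<n. exp (- (real i / real (k - n))))"
    by (simp add: exp_sum[symmetric] sum_negf sum_divide_distrib)
  also have "\<dots> \<le> (\<Prod>i<n. real (k - i) / real k)"
    by (intro prod_mono) (use bound in auto)
  finally show ?thesis .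
qed

section \<open>Telescoping bounds for the sum of \<open>exp (- a / k)\<close>\<close>

text \<open>By the mean value theorem the increment is \<open>(a + 2 z) exp (- a / z)\<close> with
  \<open>k < z < k + 1\<close>. This is increasing in \<open>z\<close>; the lower bound also drops
  \<open>2 z\<close>.\<close>

lemma square_exp_increment:
  fixes a :: real and k :: nat
  defines "G \<equiv> \<lambda>x. x\<^sup>2 * exp (- a / x)"
  assumes a: "0 \<le> a" and k: "1 \<le> k"
  shows "a * exp (- a / real k) \<le> G (real (Suc k)) - G (real k)"
    "G (real (Suc k)) - G (real k) \<le> (a + 2 * real (Suc k)) * exp (- a / real (Suc k))"
proof -
  have der: "(G has_real_derivative (a + 2 * x) * exp (- a / x)) (at x)" if "x > 0" for x
    unfolding G_def using that
    by (auto intro!: derivative_eq_intros simp: field_simps power2_eq_square)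
  obtain z where z: "real k < z" "z < real (Suc k)"
    "G (real (Suc k)) - G (real k) = (real (Suc k) - real k) * ((a + 2 * z) * exp (- a / z))"
    using MVT2[of "real k" "real (Suc k)" G "\<lambda>x. (a + 2 * x) * exp (- a / x)"] der k by auto
  have "exp (- a / real k) \<le> exp (- a / z)" "exp (- a / z) \<le> exp (- a / real (Suc k))"
    using z a k by (auto intro!: divide_left_mono simp del: of_nat_Suc)
  then have "a * exp (- a / real k) \<le> (a + 2 * z) * exp (- a / z)"
    "(a + 2 * z) * exp (- a / z) \<le> (a + 2 * real (Suc k)) * exp (- a / real (Suc k))"
    using z a k by (auto intro!: mult_mono simp del: of_nat_Suc)
  then show "a * exp (- a / real k) \<le> G (real (Suc k)) - G (real k)"
    "G (real (Suc k)) - G (real k) \<le> (a + 2 * real (Suc k)) * exp (- a / real (Suc k))"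
    using z(3) by auto
qed

text \<open>Each term is charged to the interval on its right, so the increments telescope to
  \<open>G (m + 1) - G 1\<close> with \<open>G 1 \<ge> 0\<close>.\<close>

lemma sum_exp_upper:
  fixes a :: real
  assumes "0 \<le> a"
  shows "a * (\<Sum>k = 1..m. exp (- a / real k)) \<le> (real (Suc m))\<^sup>2 * exp (- a / real (Suc m))"
proof (induction m)
  case (Suc m)
  then show ?case
    using square_exp_increment(1)[OF assms, of "Suc m"] by (simp add: algebra_simps)
qed auto

text \<open>Each term is compared with the interval on its left, and the varying factors
  \<open>a + 2 k\<close> are all enlarged to \<open>a + 2 m\<close>.\<close>

lemma sum_exp_lower:
  fixes a :: real
  assumes "0 \<le> a"
  shows "(real m)\<^sup>2 * exp (- a / real m) \<le> (a + 2 * real m) * (\<Sum>k = 1..m. exp (- a / real k))"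
proof (induction m)
  case (Suc m)
  let ?S = "\<lambda>m. \<Sum>k = 1..m. exp (- a / real k)"
  show ?case
  proof (cases "m = 0")
    \<comment> \<open>The increment bound starts at \<open>k = 1\<close>, so the first term is
      checked directly: \<open>exp (- a) \<le> (a + 2) exp (- a)\<close>.\<close>
    case True
    then show ?thesis using assms by (simp add: algebra_simps)
  next
    case False
    have "0 \<le> ?S m" by (intro sum_nonneg) auto
    then have "(a + 2 * real m) * ?S m \<le> (a + 2 * real (Suc m)) * ?S m"
      by (intro mult_right_mono) auto
    with Suc square_exp_increment(2)[OF assms, of m] False show ?thesis
      by (simp add: algebra_simps)
  qed
qed auto

lemma square_exp_mono:
  fixes a x y :: real
  assumes "0 \<le> a" "0 < x" "x \<le> y"
  shows "x\<^sup>2 * exp (- a / x) \<le> y\<^sup>2 * exp (- a / y)"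
  using assms by (intro mult_mono power_mono) (auto intro!: divide_left_mono)

section \<open>Bounds for the expected number of detachments\<close>

lemma expected_detached_upper:
  assumes "2 \<le> n" "0 \<le> x"
  defines "a \<equiv> real n * (real n - 1) / 2"
  shows "expected_detached n x \<le> (x + 1)\<^sup>2 * exp (- a / (x + 1)) / a"
proof -
  define m where "m = nat \<lfloor>x\<rfloor>"
  \<comment> \<open>Monotonicity of \<open>G\<close> will trade the floor for \<open>x + 1\<close>,
    leaving an expression without integer parts.\<close>
  have m: "real (Suc m) \<le> x + 1" using assms by (auto simp: m_def)
  have a: "0 < a" using assms by (auto simp: a_def)
  have "a * expected_detached n x \<le> a * (\<Sum>k = 1..m. exp (- a / real k))"
    unfolding expected_detached_eq m_def[symmetric] a_def[symmetric]
    using a prod_one_minus_le_exp[of _ n, folded a_def] by (intro mult_left_mono sum_mono) auto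
  also have "\<dots> \<le> (real (Suc m))\<^sup>2 * exp (- a / real (Suc m))"
    using a by (intro sum_exp_upper) auto
  also have "\<dots> \<le> (x + 1)\<^sup>2 * exp (- a / (x + 1))"
    using a m by (intro square_exp_mono) auto
  finally show ?thesis using a by (simp add: field_simps)
qed

lemma expected_detached_lower:
  assumes "2 \<le> n" "real n + 2 \<le> x"
  defines "a \<equiv> real n * (real n - 1) / 2"
  shows "(x - 1 - real n)\<^sup>2 * exp (- a / (x - 1 - real n)) / (a + 2 * x) \<le> expected_detached n x"
proof -
  \<comment> \<open>The times up to \<open>n\<close> are discarded, and the index
    \<open>k - n\<close> of the remaining ones runs up to \<open>m\<close>.\<close>
  define m where "m = nat \<lfloor>x\<rfloor> - n"
  have "n \<le> nat \<lfloor>x\<rfloor>" using assms by linarith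
  then have floor: "nat \<lfloor>x\<rfloor> = m + n" by (simp add: m_def)
  have m: "x - 1 - real n \<le> real m" "real m \<le> x"
    using floor assms by linarith+
  have a: "0 < a" using assms by (auto simp: a_def)
  have S: "0 \<le> (\<Sum>k = 1..m. exp (- a / real k))" by (intro sum_nonneg) auto
  \<comment> \<open>The assumption \<open>real n + 2 \<le> x\<close> keeps
    \<open>x - 1 - real n\<close> positive, as monotonicity of \<open>G\<close> requires.\<close>
  have "(x - 1 - real n)\<^sup>2 * exp (- a / (x - 1 - real n)) \<le> (real m)\<^sup>2 * exp (- a / real m)"
    using a m assms by (intro square_exp_mono) auto
  also have "\<dots> \<le> (a + 2 * real m) * (\<Sum>k = 1..m. exp (- a / real k))"
    using a by (intro sum_exp_lower) auto
  also have "\<dots> \<le> (a + 2 * x) * (\<Sum>k = 1..m. exp (- a / real k))"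
    using m S by (intro mult_right_mono) auto
  also have "\<dots> \<le> (a + 2 * x) * expected_detached n x"
  proof (rule mult_left_mono)
    have "(\<Sum>k = 1..m. exp (- a / real k)) = (\<Sum>k = 1 + n..m + n. exp (- a / real (k - n)))"
      by (subst sum.shift_bounds_cl_nat_ivl) simp
    also have "\<dots> \<le> (\<Sum>k = 1 + n..m + n. \<Prod>i<n. real (k - i) / real k)"
      using exp_le_prod_one_minus[of n, folded a_def] by (intro sum_mono) auto
    also have "\<dots> \<le> (\<Sum>k = 1..m + n. \<Prod>i<n. real (k - i) / real k)"
      by (intro sum_mono2) (auto intro!: prod_nonneg)
    finally show "(\<Sum>k = 1..m. exp (- a / real k)) \<le> expected_detached n x"
      by (simp add: expected_detached_eq floor)
  qed (use a assms(2) in auto)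
  finally show ?thesis
    using a assms(2) by (subst pos_divide_le_eq) (auto simp: mult.commute)
qed

text \<open>Serves to replace an arbitrary horizon by an explicit one that bounds it.\<close>

lemma expected_detached_mono: "x \<le> y \<Longrightarrow> expected_detached n x \<le> expected_detached n y"
  unfolding expected_detached_eq
  by (intro sum_mono2) (auto intro!: prod_nonneg nat_mono floor_mono)

lemma expected_detached_nonneg: "0 \<le> expected_detached n x"
  unfolding expected_detached_eq by (auto intro!: sum_nonneg prod_nonneg)

text \<open>Counts are nonnegative, so \<open>L^1\<close> convergence to 0 amounts to convergence of
  the expectations.\<close>

lemma integral_abs_num_detached:
  "(\<integral>\<omega>. \<bar>num_detached n x \<omega>\<bar> \<partial>detachment_space n) = expected_detached n x"
proof -
  have "0 \<le> num_detached n x \<omega>" for \<omega>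
    unfolding num_detached_def detached_def by (intro sum_nonneg) auto
  then show ?thesis by (simp add: expected_detached_def)
qed

section \<open>Asymptotics on explicit time scales\<close>

text \<open>For \<open>h = n\<^sup>2 / (c ln n)\<close>, \<open>a / h\<close> is about
  \<open>(c / 2) ln n\<close> and \<open>h\<^sup>2 / a\<close> about
  \<open>2 n\<^sup>2 / (c ln n)\<^sup>2\<close>. The upper bound thus has order \<open>n\<close> to
  the power \<open>2 - c / 2\<close>, up to logarithms, whence the threshold 4.\<close>

lemma expected_detached_tendsto_0:
  fixes c :: real
  assumes c: "4 < c"
  shows "(\<lambda>n. expected_detached n ((real n)\<^sup>2 / (c * ln (real n)))) \<longlonglongrightarrow> 0"
proof (rule tendsto_sandwich[OF _ _ tendsto_const])
  define h where "h = (\<lambda>n. (real n)\<^sup>2 / (c * ln (real n)))"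
  have "\<forall>\<^sub>F n in sequentially. 2 \<le> n \<and> 0 \<le> h n"
    unfolding h_def using eventually_ge_at_top[of 2]
    by eventually_elim (use c in auto)
  then show "\<forall>\<^sub>F n in sequentially. expected_detached n (h n) \<le>
      (h n + 1)\<^sup>2 * exp (- (real n * (real n - 1) / 2) / (h n + 1)) / (real n * (real n - 1) / 2)"
    by eventually_elim (use expected_detached_upper in auto)
  show "(\<lambda>n. (h n + 1)\<^sup>2 * exp (- (real n * (real n - 1) / 2) / (h n + 1)) /
      (real n * (real n - 1) / 2)) \<longlonglongrightarrow> 0"
    unfolding h_def using c by real_asymp
qed (simp add: expected_detached_nonneg)

text \<open>The lower bound has the same power of \<open>n\<close>, now positive: the shift by
  \<open>n + 1\<close> changes the exponent only by \<open>o(1)\<close>, and \<open>2 h\<close> is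
  negligible against \<open>a\<close>.\<close>

lemma expected_detached_at_top:
  fixes c :: real
  assumes c: "0 < c" "c < 4"
  shows "filterlim (\<lambda>n. expected_detached n ((real n)\<^sup>2 / (c * ln (real n)))) at_top sequentially"
proof (rule filterlim_at_top_mono)
  define h where "h = (\<lambda>n. (real n)\<^sup>2 / (c * ln (real n)))"
  have "\<forall>\<^sub>F n in sequentially. real n + 2 \<le> h n"
    unfolding h_def using c by real_asymp
  with eventually_ge_at_top[of 2]
  show "\<forall>\<^sub>F n in sequentially. (h n - 1 - real n)\<^sup>2 *
      exp (- (real n * (real n - 1) / 2) / (h n - 1 - real n)) / (real n * (real n - 1) / 2 + 2 * h n)
      \<le> expected_detached n (h n)"
    by eventually_elim (use expected_detached_lower in auto)
  show "filterlim (\<lambda>n. (h n - 1 - real n)\<^sup>2 *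
      exp (- (real n * (real n - 1) / 2) / (h n - 1 - real n)) /
      (real n * (real n - 1) / 2 + 2 * h n)) at_top sequentially"
    unfolding h_def using c by real_asymp
qed

text \<open>Here \<open>a / h\<close> is \<open>2 ln n - 2 ln (ln n) + y\<close> up to
  \<open>o(1)\<close>, so \<open>exp (- a / h)\<close> is about
  \<open>exp (- y) (ln n)\<^sup>2 / n\<^sup>2\<close>, while \<open>h\<^sup>2 / a\<close> is about
  \<open>n\<^sup>2 / (8 (ln n)\<^sup>2)\<close>. Both bounds therefore have the same limit.\<close>

lemma expected_detached_critical:
  fixes y :: real
  defines "h \<equiv> \<lambda>n. (real n)\<^sup>2 / (2 * (2 * ln (real n) - 2 * ln (ln (real n)) + y))"
  shows "(\<lambda>n. expected_detached n (h n)) \<longlonglongrightarrow> exp (- y) / 8"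
proof (rule tendsto_sandwich)
  have large: "\<forall>\<^sub>F n in sequentially. 2 \<le> n \<and> real n + 2 \<le> h n"
    unfolding h_def by (intro eventually_conj eventually_ge_at_top) real_asymp
  show "\<forall>\<^sub>F n in sequentially. expected_detached n (h n) \<le>
      (h n + 1)\<^sup>2 * exp (- (real n * (real n - 1) / 2) / (h n + 1)) / (real n * (real n - 1) / 2)"
    using large by eventually_elim (use expected_detached_upper in auto)
  show "\<forall>\<^sub>F n in sequentially. (h n - 1 - real n)\<^sup>2 *
      exp (- (real n * (real n - 1) / 2) / (h n - 1 - real n)) / (real n * (real n - 1) / 2 + 2 * h n)
      \<le> expected_detached n (h n)"
    using large by eventually_elim (use expected_detached_lower in auto)
  show "(\<lambda>n. (h n + 1)\<^sup>2 * exp (- (real n * (real n - 1) / 2) / (h n + 1)) /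
      (real n * (real n - 1) / 2)) \<longlonglongrightarrow> exp (- y) / 8"
    unfolding h_def by real_asymp (simp add: power2_eq_square)
  show "(\<lambda>n. (h n - 1 - real n)\<^sup>2 *
      exp (- (real n * (real n - 1) / 2) / (h n - 1 - real n)) /
      (real n * (real n - 1) / 2 + 2 * h n)) \<longlonglongrightarrow> exp (- y) / 8"
    unfolding h_def by real_asymp (simp add: power2_eq_square)
qed

section \<open>Passage to arbitrary equivalent time scales\<close>

text \<open>The quotient of \<open>k n\<close> and its scale tends to 1, which lies strictly between
  \<open>c / d'\<close> and \<open>c / d\<close>.\<close>

lemma asymp_equiv_squeeze:
  fixes c d d' :: real
  assumes k: "k \<sim>[sequentially] (\<lambda>n. (real n)\<^sup>2 / (c * ln (real n)))"
    and d: "0 < d" "d < c" "c < d'"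
  shows "\<forall>\<^sub>F n in sequentially. k n \<le> (real n)\<^sup>2 / (d * ln (real n))"
    "\<forall>\<^sub>F n in sequentially. (real n)\<^sup>2 / (d' * ln (real n)) \<le> k n"
proof -
  \<comment> \<open>Asymptotic equivalence yields a limit of plain quotients once the scale is
    nonzero; \<open>n > 1\<close> gives \<open>ln n > 0\<close>.\<close>
  have nz: "\<forall>\<^sub>F n in sequentially. (real n)\<^sup>2 / (c * ln (real n)) \<noteq> 0"
    using eventually_gt_at_top[of 1] by eventually_elim (use d in auto)
  have lim: "(\<lambda>n. k n / ((real n)\<^sup>2 / (c * ln (real n)))) \<longlonglongrightarrow> 1"
    using asymp_equivD_strong[OF k] nz by (simp add: eventually_mono)
  have gap: "1 < c / d" "c / d' < 1" using d by auto
  show "\<forall>\<^sub>F n in sequentially. k n \<le> (real n)\<^sup>2 / (d * ln (real n))"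
    using order_tendstoD(2)[OF lim gap(1)] eventually_gt_at_top[of 1]
    by eventually_elim (use d in \<open>auto simp: field_simps\<close>)
  show "\<forall>\<^sub>F n in sequentially. (real n)\<^sup>2 / (d' * ln (real n)) \<le> k n"
    using order_tendstoD(1)[OF lim gap(2)] eventually_gt_at_top[of 1]
    by eventually_elim (use d in \<open>auto simp: field_simps\<close>)
qed

theorem theorem5p1:
  shows "(\<forall>(c::real) (k :: nat \<Rightarrow> real).
            c > 0 \<longrightarrow> k \<sim>[sequentially] (\<lambda>n. (real n)\<^sup>2 / (c * ln (real n))) \<longrightarrow>
              (c > 4 \<longrightarrow> (\<lambda>n. expected_detached n (k n)) \<longlonglongrightarrow> 0 \<and>
                        tendsto_zero_L1 detachment_space (\<lambda>n. num_detached n (k n))) \<and>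
              (c < 4 \<longrightarrow> filterlim (\<lambda>n. expected_detached n (k n)) at_top sequentially)) \<and>
         (\<forall>(y::real) (k :: nat \<Rightarrow> real).
            y > 0 \<longrightarrow>
            k = (\<lambda>n. (real n)\<^sup>2 / (2 * (2 * ln (real n) - 2 * ln (ln (real n)) + y))) \<longrightarrow>
              k \<sim>[sequentially] (\<lambda>n. (real n)\<^sup>2 / (4 * ln (real n))) \<and>
              (\<lambda>n. expected_detached n (k n)) \<longlonglongrightarrow> exp (- y) / 8)"
proof (intro conjI allI impI)
  fix c :: real and k :: "nat \<Rightarrow> real"
  assume c: "c > 0" and k: "k \<sim>[sequentially] (\<lambda>n. (real n)\<^sup>2 / (c * ln (real n)))"
  {
    assume "c > 4"
    \<comment> \<open>The gap between 4 and \<open>c\<close> absorbs the error of the asymptotic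
      equivalence; below, \<open>c + 1\<close> just supplies a constant above
      \<open>c\<close>.\<close>
    then obtain d where d: "4 < d" "d < c" using dense by blast
    have "\<forall>\<^sub>F n in sequentially. k n \<le> (real n)\<^sup>2 / (d * ln (real n))"
      using asymp_equiv_squeeze(1)[OF k, of d "c + 1"] d by auto
    then have "\<forall>\<^sub>F n in sequentially.
        expected_detached n (k n) \<le> expected_detached n ((real n)\<^sup>2 / (d * ln (real n)))"
      by eventually_elim (rule expected_detached_mono)
    then show lim: "(\<lambda>n. expected_detached n (k n)) \<longlonglongrightarrow> 0"
      by (rule tendsto_sandwich[OF _ _ tendsto_const expected_detached_tendsto_0[OF d(1)], rotated])
         (simp add: expected_detached_nonneg)
    show "tendsto_zero_L1 detachment_space (\<lambda>n. num_detached n (k n))"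
      unfolding tendsto_zero_L1_def integral_abs_num_detached
      using lim expected_detached_eq(1) by auto
  }
  assume "c < 4"
  \<comment> \<open>Symmetrically, \<open>d\<close> lies between \<open>c\<close> and 4, and
    \<open>c / 2\<close> supplies a positive constant below \<open>c\<close>.\<close>
  then obtain d where d: "c < d" "d < 4" using dense by blast
  have "\<forall>\<^sub>F n in sequentially. (real n)\<^sup>2 / (d * ln (real n)) \<le> k n"
    using asymp_equiv_squeeze(2)[OF k, of "c / 2" d] c d by auto
  then have "\<forall>\<^sub>F n in sequentially.
      expected_detached n ((real n)\<^sup>2 / (d * ln (real n))) \<le> expected_detached n (k n)"
    by eventually_elim (rule expected_detached_mono)
  then show "filterlim (\<lambda>n. expected_detached n (k n)) at_top sequentially"
    by (rule filterlim_at_top_mono[rotated]) (use expected_detached_at_top[of d] c d in auto)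
next
  fix y :: real and k :: "nat \<Rightarrow> real"
  assume k: "k = (\<lambda>n. (real n)\<^sup>2 / (2 * (2 * ln (real n) - 2 * ln (ln (real n)) + y)))"
  show "k \<sim>[sequentially] (\<lambda>n. (real n)\<^sup>2 / (4 * ln (real n)))"
    unfolding k by real_asymp
  show "(\<lambda>n. expected_detached n (k n)) \<longlonglongrightarrow> exp (- y) / 8"
    unfolding k by (rule expected_detached_critical)
qed

end
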